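(* Let the integers $M(n)$, $n\ge 0$, be defined by $\sum_{n\geq 0}M(n)q^n=\dfrac{f_2^5f_5^5}{f_1f_{10}}$. Then for all integers $\alpha\geq 1$, \[ \sum_{n\geq 0}M(5^{\alpha}n+5^{\alpha}-1)q^n=5^{\alpha}\Psi_{\alpha}, \] where \[ \Psi_{\alpha} = \begin{cases} q\dfrac{f_1^5 f_{10}^5}{f_2 f_5}, & \text{if } \alpha \text{ is odd}, \\[10pt] \dfrac{f_2^5 f_5^5}{f_1 f_{10}}, & \text{if } \alpha \text{ is even}. \end{cases} \]
   Context: For a positive integer $k$, $f_k:=(q^k;q^k)_\infty=\prod_{i\geq 1}(1-q^{ki})$, regarded as a formal power series in $q$ with integer coefficients (invertible, since its constant term is $1$). The identities are identities of formal power series in $q$. *)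

theory Defs
  imports
    "HOL-Analysis.Infinite_Products"
    "HOL-Computational_Algebra.Formal_Power_Series"
begin

text \<open>
  The product \<open>(q^k; q^k)\<^sub>\<infinity>\<close>; the limit is taken in the metric on formal power series, and the
  index is shifted because \<^const>\<open>prodinf\<close> starts at \<open>0\<close>.
  For \<open>k = 0\<close> the product has no useful meaning; it is only used for \<open>k > 0\<close>.
\<close>

definition euler_prod :: "nat \<Rightarrow> int fps" where
  "euler_prod k = (\<Prod>i. 1 - fps_X ^ (k * Suc i))"

lemma euler_prod_partial_nth:
  assumes "k > 0" "m \<le> n"
  shows "fps_nth (\<Prod>i\<le>n. 1 - fps_X ^ (k * Suc i) :: int fps) m =
         fps_nth (\<Prod>i\<le>m. 1 - fps_X ^ (k * Suc i) :: int fps) m"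
  using assms(2)
proof (induction n rule: dec_induct)
  case (step n)
  have "m < k * Suc (Suc n)"
    using step.hyps assms(1) mult_le_mono1[of 1 k "Suc (Suc n)"] by simp
  then show ?case
    using step.IH by (simp add: right_diff_distrib fps_X_power_mult_right_nth del: mult_Suc_right power_Suc)
qed simp

lemma
  assumes "k > 0"
  shows has_prod_euler_prod: "(\<lambda>i. 1 - fps_X ^ (k * Suc i)) has_prod euler_prod k"
    and euler_prod_nth:
      "fps_nth (euler_prod k) m = fps_nth (\<Prod>i\<le>m. 1 - fps_X ^ (k * Suc i)) m"
proof -
  define L :: "int fps" where
    "L = Abs_fps (\<lambda>m. fps_nth (\<Prod>i\<le>m. 1 - fps_X ^ (k * Suc i)) m)"
  have "(\<lambda>n. \<Prod>i\<le>n. 1 - fps_X ^ (k * Suc i)) \<longlonglongrightarrow> L"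
    unfolding tendsto_fps_iff
  proof
    fix m
    show "\<forall>\<^sub>F n in sequentially. fps_nth (\<Prod>i\<le>n. 1 - fps_X ^ (k * Suc i)) m = fps_nth L m"
      using eventually_ge_at_top[of m]
      by eventually_elim (unfold L_def fps_nth_Abs_fps, rule euler_prod_partial_nth[OF assms])
  qed
  moreover have "fps_nth L 0 = 1"
    using assms by (simp add: L_def)
  then have "L \<noteq> 0"
    by auto
  ultimately have *: "(\<lambda>i. 1 - fps_X ^ (k * Suc i)) has_prod L"
    by (simp add: has_prod_def raw_has_prod_def)
  then have "euler_prod k = L"
    unfolding euler_prod_def by (rule has_prod_unique[symmetric])
  with * show "(\<lambda>i. 1 - fps_X ^ (k * Suc i)) has_prod euler_prod k"
    and "fps_nth (euler_prod k) m = fps_nth (\<Prod>i\<le>m. 1 - fps_X ^ (k * Suc i)) m"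
    by (simp_all add: L_def)
qed

lemma euler_prod_nth_0: "k > 0 \<Longrightarrow> fps_nth (euler_prod k) 0 = 1"
  by (simp add: euler_prod_nth)

text \<open>
  Division of integer power series by a series with constant term \<open>1\<close>. The generic division on
  \<^typ>\<open>'a fps\<close> needs an inverse on the coefficients, which \<^typ>\<open>int\<close> does not have.
\<close>

definition fps_quot :: "int fps \<Rightarrow> int fps \<Rightarrow> int fps" (infixl \<open>'/'/\<^sub>q\<close> 70) where
  "g //\<^sub>q h = g * fps_right_inverse h 1"

lemma fps_quot_mult: "fps_nth h 0 = 1 \<Longrightarrow> (g //\<^sub>q h) * h = g"
  using fps_right_inverse[of h 1] by (simp add: fps_quot_def mult_ac)

definition Psi :: "nat \<Rightarrow> int fps" where
  "Psi \<alpha> =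
    (if odd \<alpha> then fps_X * ((euler_prod 1 ^ 5 * euler_prod 10 ^ 5) //\<^sub>q (euler_prod 2 * euler_prod 5))
     else (euler_prod 2 ^ 5 * euler_prod 5 ^ 5) //\<^sub>q (euler_prod 1 * euler_prod 10))"

end

theory Submission
  imports Defs "HOL-Computational_Algebra.Polynomial"
begin

text \<open>
  Write \<open>f\<^sub>k\<close> for \<open>euler_prod k\<close> and \<open>U\<close> for the operator that keeps the coefficients of
  \<open>q\<^bsup>5n+4\<^esup>\<close>. Applying \<open>U\<close> to the series with coefficients \<open>M(5\<^sup>\<alpha>n + 5\<^sup>\<alpha> - 1)\<close> gives the series for
  \<open>\<alpha> + 1\<close>, so everything follows from \<open>U(\<Psi>\<^sub>\<alpha>) = 5 \<Psi>\<^bsub>\<alpha>+1\<^esub>\<close>, where \<open>\<Psi>\<^sub>0\<close> is the generating function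
  of \<open>M\<close>.

  Both series \<open>\<Psi>\<close> are a product of a factor \<open>A\<^sub>k = f\<^bsub>2k\<^esub>\<^sup>5 / f\<^sub>k\<close> and a factor
  \<open>B\<^sub>k = f\<^sub>k\<^sup>5 / f\<^bsub>2k\<^esub>\<close>: for even \<open>\<alpha>\<close> it is \<open>A\<^sub>1 B\<^sub>5\<close>, for odd \<open>\<alpha>\<close> it is \<open>q B\<^sub>1 A\<^sub>5\<close>. The factor
  of index \<open>5\<close> is a series in \<open>q\<^sup>5\<close>, so it passes through \<open>U\<close> and turns into the factor of index
  \<open>1\<close>. What is left is \<open>U(A\<^sub>1) = 5 q A\<^sub>5\<close> and \<open>U(q B\<^sub>1) = 5 B\<^sub>5\<close>.

  These hold because \<open>A\<^sub>k\<close> and \<open>B\<^sub>k\<close> are theta series of binary quadratic forms. The identities of Gauss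
  and Jacobi, in the form
  \[ \sum_{m \in Z} q^{m(m+1)/2} = 2 f_2^2/f_1, \quad
     \sum_{m \in Z} (-1)^m q^{m^2} = f_1^2/f_2, \quad
     \sum_{m \in Z} (-1)^m (2m+1) q^{m(m+1)/2} = 2 f_1^3, \]
  show that \<open>4 A\<^sub>1\<close> is the sum of \<open>(-1)\<^sup>l (2l+1) q\<^sup>N\<close> over all integers \<open>m\<close>, \<open>l\<close> with
  \<open>8N + 3 = (2m+1)\<^sup>2 + 2(2l+1)\<^sup>2\<close>, and similarly \<open>2 B\<^sub>1\<close> with \<open>8N + 1 = 8m\<^sup>2 + (2l+1)\<^sup>2\<close>. Both forms
  are anisotropic modulo \<open>5\<close>. So if \<open>5\<close> divides the left-hand side (that is, \<open>N \<equiv> 4\<close> and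
  \<open>N \<equiv> 3\<close> modulo \<open>5\<close>, respectively), then it divides both of the numbers on the right that are
  squared. Dividing these two numbers by \<open>5\<close> turns the selected terms into the original series in
  \<open>q\<^sup>5\<close>; the coefficient \<open>2l + 1\<close> contributes the factor \<open>5\<close>.

  The identities of Gauss and Jacobi are obtained from finite versions, which are the \<open>q\<close>-binomial
  theorem evaluated (or differentiated) at a suitable power of \<open>q\<close>. A middle \<open>q\<close>-binomial coefficient
  tends to \<open>1 / f\<^sub>1\<close>, and all limits are expressed as congruences modulo powers of the variable.
\<close>

section \<open>Congruences of power series modulo a power of the variable\<close>

lemma fps_X_power_dvd_iff_nth:
  fixes f :: "int fps"
  shows "fps_X ^ N dvd f \<longleftrightarrow> (\<forall>m<N. fps_nth f m = 0)"
proof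
  assume "\<forall>m<N. fps_nth f m = 0"
  then have "fps_cutoff N f = 0"
    by (auto simp: fps_eq_iff)
  then have "f = fps_X ^ N * fps_shift N f"
    using fps_shift_cutoff'[of N f] by simp
  then show "fps_X ^ N dvd f"
    by (metis dvd_triv_left)
qed (auto simp: fps_X_power_mult_nth)

lemma fps_eq_if_X_power_dvd:
  fixes f g :: "int fps"
  assumes "\<And>N. fps_X ^ N dvd f - g"
  shows "f = g"
  using assms[of "Suc n" for n] by (auto simp: fps_eq_iff fps_X_power_dvd_iff_nth simp del: power_Suc)

lemma fps_X_power_dvd_unit_mult:
  fixes u f :: "int fps"
  assumes "fps_nth u 0 = 1" "fps_X ^ N dvd u * f"
  shows "fps_X ^ N dvd f"
proof -
  have "f = (u * f) * fps_right_inverse u 1"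
    using fps_right_inverse[of u 1] assms(1) by (simp add: mult_ac)
  then show ?thesis
    using assms(2) by (metis dvd_mult2)
qed

lemma dvd_cong_mult:
  fixes d :: "'a :: comm_ring_1"
  assumes "d dvd a - b" "d dvd a' - b'"
  shows "d dvd a * a' - b * b'"
proof -
  have "a * a' - b * b' = (a - b) * a' + b * (a' - b')"
    by (simp add: algebra_simps)
  then show ?thesis
    using assms by simp
qed

lemma dvd_cong_trans:
  fixes d :: "'a :: comm_ring_1"
  assumes "d dvd a - b" "d dvd b - c"
  shows "d dvd a - c"
  using dvd_add[OF assms] by simp

lemma dvd_cong_sym:
  fixes d :: "'a :: comm_ring_1"
  assumes "d dvd a - b"
  shows "d dvd b - a"
  using assms by (metis dvd_minus_iff minus_diff_eq)

section \<open>Gaussian binomial coefficients and the \<open>q\<close>-binomial theorem\<close>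

text \<open>
  The Gaussian binomial coefficient, by its Pascal recursion. A quotient of products would need
  division; the recursion makes sense in every commutative ring.
\<close>

fun qbinom :: "'a :: comm_ring_1 \<Rightarrow> nat \<Rightarrow> nat \<Rightarrow> 'a" where
  "qbinom q n 0 = 1"
| "qbinom q 0 (Suc k) = 0"
| "qbinom q (Suc n) (Suc k) = qbinom q n k + q ^ Suc k * qbinom q n (Suc k)"

lemma qbinom_eq_0: "n < k \<Longrightarrow> qbinom q n k = 0"
  by (induction q n k rule: qbinom.induct) auto

text \<open>
  The homogeneous form in \<open>x\<close> and \<open>y\<close> allows a choice such as \<open>y = q\<^sup>n\<close> where the usual form
  \<open>y = 1\<close> would require \<open>x = q\<^bsup>-n\<^esup>\<close>. For the induction, split off the factor for \<open>i = 0\<close>: the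
  remaining product has the same shape with \<open>x q\<close> instead of \<open>x\<close>.
\<close>

theorem qbinomial_theorem:
  "(\<Prod>i<n. y + x * q ^ i) = (\<Sum>k\<le>n. q ^ (k choose 2) * qbinom q n k * x ^ k * y ^ (n - k))"
proof (induction n arbitrary: x)
  case (Suc n)
  define t where "t = (\<lambda>k. q ^ (k choose 2) * q ^ k * qbinom q n k * x ^ k)"
  have c2: "Suc k choose 2 = (k choose 2) + k" for k
    by (simp add: numeral_2_eq_2)
  have y: "y ^ (Suc n - k) = y * y ^ (n - k)" if "k \<le> n" for k
    using that by (simp add: Suc_diff_le)
  have "(\<Prod>i<Suc n. y + x * q ^ i) = (y + x) * (\<Prod>i<n. y + (x * q) * q ^ i)"
    by (simp add: prod.lessThan_Suc_shift mult_ac del: prod.lessThan_Suc)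
  also have "\<dots> = (y + x) * (\<Sum>k\<le>n. t k * y ^ (n - k))"
    unfolding Suc.IH by (simp add: t_def power_mult_distrib mult_ac)
  also have "\<dots> = (\<Sum>k\<le>n. t k * y ^ (Suc n - k)) + (\<Sum>k\<le>n. x * t k * y ^ (n - k))"
    by (simp add: ring_distribs sum_distrib_left sum.distrib y mult_ac)
  also have "(\<Sum>k\<le>n. t k * y ^ (Suc n - k)) = (\<Sum>k\<le>Suc n. t k * y ^ (Suc n - k))"
    by (simp add: t_def qbinom_eq_0)
  also have "\<dots> = y ^ Suc n + (\<Sum>k\<le>n. t (Suc k) * y ^ (n - k))"
    by (subst sum.atMost_Suc_shift) (simp add: t_def numeral_2_eq_2)
  also have "y ^ Suc n + (\<Sum>k\<le>n. t (Suc k) * y ^ (n - k)) + (\<Sum>k\<le>n. x * t k * y ^ (n - k))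
      = y ^ Suc n + (\<Sum>k\<le>n. (t (Suc k) + x * t k) * y ^ (n - k))"
    by (simp add: sum.distrib ring_distribs)
  also have "(\<lambda>k. t (Suc k) + x * t k) =
      (\<lambda>k. q ^ (Suc k choose 2) * qbinom q (Suc n) (Suc k) * x ^ Suc k)"
    by (simp add: fun_eq_iff t_def c2 power_add algebra_simps)
  also have "y ^ Suc n + (\<Sum>k\<le>n. q ^ (Suc k choose 2) * qbinom q (Suc n) (Suc k) * x ^ Suc k * y ^ (n - k))
     = (\<Sum>k\<le>Suc n. q ^ (k choose 2) * qbinom q (Suc n) k * x ^ k * y ^ (Suc n - k))"
    by (subst sum.atMost_Suc_shift) (simp add: numeral_2_eq_2)
  finally show ?case .
qed (simp add: numeral_2_eq_2)

section \<open>Finite Euler products and their limits\<close>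

text \<open>
  The \<open>q\<close>-Pochhammer symbol \<open>(q; q)\<^sub>n\<close>.
\<close>

definition qpoch :: "'a :: comm_ring_1 \<Rightarrow> nat \<Rightarrow> 'a" where
  "qpoch q n = (\<Prod>i<n. 1 - q ^ Suc i)"

lemma qpoch_0 [simp]: "qpoch q 0 = 1"
  and qpoch_Suc: "qpoch q (Suc n) = qpoch q n * (1 - q ^ Suc n)"
  by (simp_all add: qpoch_def)

lemma qbinom_mult_qpoch: "qbinom q (n + m) m * qpoch q n * qpoch q m = qpoch q (n + m)"
proof (induction "n + m" arbitrary: n m)
  case (Suc N)
  show ?case
  proof (cases n)
    case n: 0
    then obtain m' where m: "m = Suc m'"
      using Suc.hyps by (cases m) auto
    then show ?thesis
      using Suc.hyps(1)[of 0 m'] Suc.hyps(2) n by (simp add: qpoch_Suc qbinom_eq_0 mult_ac flip: mult.assoc)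
  next
    case n: (Suc n')
    show ?thesis
    proof (cases m)
      case m: (Suc m')
      have 1: "qbinom q (n' + m) m * qpoch q n' * qpoch q m = qpoch q (n' + m)"
        using Suc.hyps n by (intro Suc.hyps(1)) auto
      have 2: "qbinom q (n + m') m' * qpoch q n * qpoch q m' = qpoch q (n + m')"
        using Suc.hyps m by (intro Suc.hyps(1)) auto
      have eq: "n' + m = n + m'"
        using n m by simp
      have "qbinom q (n + m) m * qpoch q n * qpoch q m =
          (1 - q ^ m) * (qbinom q (n + m') m' * qpoch q n * qpoch q m')
          + q ^ m * (1 - q ^ n) * (qbinom q (n' + m) m * qpoch q n' * qpoch q m)"
        unfolding eq unfolding n m by (simp add: qpoch_Suc algebra_simps)
      also have "\<dots> = qpoch q (n + m') * (1 - q ^ (n + m))"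
        unfolding 1 2 unfolding eq by (simp add: algebra_simps power_add)
      also have "\<dots> = qpoch q (n + m)"
        by (simp add: m qpoch_Suc)
      finally show ?thesis .
    qed simp
  qed
qed simp

text \<open>
  This is Euler's \<open>(1 - q\<^sup>i)(1 + q\<^sup>i) = 1 - q\<^bsup>2i\<^esup>\<close>; in the limit the product of the \<open>1 + q\<^sup>i\<close> becomes
  \<open>f\<^sub>2 / f\<^sub>1\<close>.
\<close>

lemma qpoch_mult_prod_plus:
  "qpoch q n * (\<Prod>i<n. 1 + q ^ Suc i) = qpoch (q ^ 2) n"
  by (simp add: qpoch_def power2_eq_square algebra_simps power_mult_distrib flip: prod.distrib)

text \<open>
  Even and odd exponents together give all exponents; in the limit the product of the
  \<open>1 - q\<^bsup>2i+1\<^esup>\<close> becomes \<open>f\<^sub>1 / f\<^sub>2\<close>.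
\<close>

lemma qpoch_square_mult_prod_odd:
  "qpoch (q ^ 2) n * (\<Prod>i<n. 1 - q ^ (2 * i + 1)) = qpoch q (2 * n)"
proof (induction n)
  case (Suc n)
  have q: "(q ^ 2) ^ Suc n = q ^ Suc (Suc (2 * n))"
    unfolding power_mult[symmetric] by simp
  have "qpoch (q ^ 2) (Suc n) * (\<Prod>i<Suc n. 1 - q ^ (2 * i + 1)) =
    (qpoch (q ^ 2) n * (\<Prod>i<n. 1 - q ^ (2 * i + 1))) * (1 - q ^ Suc (2 * n)) * (1 - q ^ Suc (Suc (2 * n)))"
    unfolding qpoch_Suc q prod.lessThan_Suc by (simp only: mult_ac Suc_eq_plus1)
  also have "\<dots> = qpoch q (2 * Suc n)"
    unfolding Suc.IH by (simp only: mult_Suc_right add_2_eq_Suc qpoch_Suc)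
  finally show ?case .
qed simp

lemma qpoch_nth_0:
  "k > 0 \<Longrightarrow> fps_nth (qpoch (fps_X ^ k :: int fps) n) 0 = 1"
  by (induction n) (simp_all add: qpoch_Suc flip: power_mult)

lemma qpoch_cong:
  "fps_X ^ (k * Suc n) dvd qpoch (fps_X ^ k :: int fps) (n + j) - qpoch (fps_X ^ k) n"
proof (induction j)
  case (Suc j)
  have "fps_X ^ (k * Suc n) dvd (fps_X ^ k :: int fps) ^ Suc (n + j)"
    unfolding power_mult[symmetric] by (intro le_imp_power_dvd mult_le_mono) auto
  then have "fps_X ^ (k * Suc n) dvd qpoch (fps_X ^ k :: int fps) (n + Suc j) - qpoch (fps_X ^ k) (n + j)"
    by (simp add: qpoch_Suc right_diff_distrib del: power_Suc)
  then show ?case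
    using Suc.IH by (rule dvd_cong_trans)
qed simp

lemma qpoch_cong_euler_prod:
  assumes k: "k > 0"
  shows "fps_X ^ (k * Suc n) dvd qpoch (fps_X ^ k) n - euler_prod k"
proof -
  have "fps_nth (qpoch (fps_X ^ k) n) m = fps_nth (euler_prod k) m" if m: "m < k * Suc n" for m
  proof -
    have "fps_nth (euler_prod k) m = fps_nth (qpoch (fps_X ^ k) (Suc m)) m"
      by (simp add: euler_prod_nth k qpoch_def lessThan_Suc_atMost power_mult del: mult_Suc_right power_Suc prod.lessThan_Suc)
    also have "\<dots> = fps_nth (qpoch (fps_X ^ k) n) m"
    proof (cases "n \<le> Suc m")
      case True
      then show ?thesis
        using qpoch_cong[of k n "Suc m - n"] m by (simp add: fps_X_power_dvd_iff_nth)
    next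
      case False
      have "m < 1 * Suc (Suc m)" by simp
      also have "\<dots> \<le> k * Suc (Suc m)" using k by (intro mult_le_mono) auto
      finally show ?thesis
        using False qpoch_cong[of k "Suc m" "n - Suc m"] by (simp add: fps_X_power_dvd_iff_nth)
    qed
    finally show ?thesis by simp
  qed
  then show ?thesis
    by (simp add: fps_X_power_dvd_iff_nth)
qed

text \<open>
  The quantitative form of \<open>qbinom q (n + m) m \<longlonglongrightarrow> 1 / (q; q)\<^sub>\<infinity>\<close> as \<open>n\<close> and \<open>m\<close> grow: the relation
  \<open>qbinom q (n + m) m * (q; q)\<^sub>n * (q; q)\<^sub>m = (q; q)\<^bsub>n+m\<^esub>\<close> is reduced modulo a power of the variable
  for which \<open>(q; q)\<^sub>m\<close> and \<open>(q; q)\<^bsub>n+m\<^esub>\<close> agree, and this unit is cancelled.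
\<close>

lemma euler_prod_mult_qbinom:
  assumes k: "k > 0" and "N \<le> k * Suc n" "N \<le> k * Suc m"
  shows "fps_X ^ N dvd euler_prod k * qbinom (fps_X ^ k) (n + m) m - 1"
proof -
  let ?q = "fps_X ^ k :: int fps"
  have n: "fps_X ^ N dvd euler_prod k - qpoch ?q n" 
    using qpoch_cong_euler_prod[OF k, of n] assms(2) by (metis dvd_cong_sym dvd_trans le_imp_power_dvd)
  have m: "fps_X ^ N dvd qpoch ?q (m + n) - qpoch ?q m"
    using qpoch_cong[of k m n] assms(3) by (metis dvd_trans le_imp_power_dvd)
  have "fps_X ^ N dvd qpoch ?q m * (qpoch ?q n * qbinom ?q (n + m) m - 1)"
    using m qbinom_mult_qpoch[of ?q n m] by (simp add: algebra_simps)
  then have "fps_X ^ N dvd qpoch ?q n * qbinom ?q (n + m) m - 1"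
    using fps_X_power_dvd_unit_mult qpoch_nth_0[OF k] by blast
  moreover have "fps_X ^ N dvd euler_prod k * qbinom ?q (n + m) m - qpoch ?q n * qbinom ?q (n + m) m"
    using n by (intro dvd_cong_mult) auto
  ultimately show ?thesis
    by (rule dvd_cong_trans[rotated])
qed

section \<open>Finite forms of the identities of Gauss and Jacobi\<close>

text \<open>
  Triangular numbers with an integer index. Every value occurs for both \<open>m\<close> and \<open>- 1 - m\<close>; summing
  over all integers instead of the natural numbers costs a factor \<open>2\<close> and makes the index set stable
  under the affine maps modulo \<open>5\<close> that are used later.
\<close>

definition tri :: "int \<Rightarrow> nat" where
  "tri m = nat (m * (m + 1) div 2)"

lemma two_tri: "2 * int (tri m) = m * (m + 1)"
proof -
  have "m * (m + 1) \<ge> 0"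
    by (cases "m \<ge> 0") (auto intro: mult_nonpos_nonpos)
  then show ?thesis
    by (simp add: tri_def)
qed

lemma tri_eqI: "2 * int t = m * (m + 1) \<Longrightarrow> tri m = t"
  using two_tri[of m] by simp

definition sgn_pow :: "int \<Rightarrow> int" where
  "sgn_pow m = (if even m then 1 else - 1)"

lemma minus_one_power_eq_sgn_pow:
  "(- 1 :: 'a :: comm_ring_1) ^ k = (- 1) ^ n * of_int (sgn_pow (int n - int k))"
  by (auto simp: sgn_pow_def minus_one_power_iff)

lemma two_choose_two: "2 * int (k choose 2) = int k * (int k - 1)"
proof (induction k)
  case (Suc k)
  have "Suc k choose 2 = (k choose 2) + k"
    by (simp add: numeral_2_eq_2)
  then show ?case
    using Suc.IH by (simp add: algebra_simps)
qed simp

lemma prod_power_eq_choose_two: "(\<Prod>i<n. q ^ i) = (q :: 'a :: comm_ring_1) ^ (n choose 2)"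
  by (induction n) (simp_all add: numeral_2_eq_2 power_add mult_ac)

lemma prod_lessThan_add:
  fixes f :: "nat \<Rightarrow> 'a :: comm_monoid_mult"
  shows "(\<Prod>i<a + b. f i) = (\<Prod>i<a. f i) * (\<Prod>i<b. f (a + i))"
  by (induction b) (simp_all add: mult_ac)

lemma prod_lower_half:
  fixes q x :: "'a :: comm_ring_1"
  shows "(\<Prod>i<n. q ^ n + x * q ^ i) = q ^ (n choose 2) * (\<Prod>i<n. q ^ Suc i + x)"
proof -
  have "(\<Prod>i<n. q ^ n + x * q ^ i) = (\<Prod>i<n. q ^ n + x * q ^ (n - Suc i))"
    by (rule prod.nat_diff_reindex[symmetric])
  also have "\<dots> = (\<Prod>i<n. q ^ (n - Suc i) * (q ^ Suc i + x))"
    by (intro prod.cong refl) (simp add: algebra_simps flip: power_add power_Suc)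
  also have "\<dots> = (\<Prod>i<n. q ^ (n - Suc i)) * (\<Prod>i<n. q ^ Suc i + x)"
    by (rule prod.distrib)
  also have "(\<Prod>i<n. q ^ (n - Suc i)) = q ^ (n choose 2)"
    by (subst prod.nat_diff_reindex) (rule prod_power_eq_choose_two)
  finally show ?thesis .
qed

text \<open>
  Completing the square: in row \<open>2n + 1\<close> of the \<open>q\<close>-binomial theorem with \<open>y = q\<^sup>n\<close>, the exponent of
  \<open>q\<close> is a constant plus the triangular number of the distance from the middle.
\<close>

lemma odd_row_exponent:
  assumes "k \<le> 2 * n + 1"
  shows "(k choose 2) + n * (2 * n + 1 - k) = (n choose 2) + n + n * n + tri (int n - int k)"
proof -
  have "2 * int ((k choose 2) + n * (2 * n + 1 - k)) =
      2 * int (k choose 2) + 2 * (int n * (2 * int n + 1 - int k))"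
    using assms by (simp add: of_nat_diff)
  also have "\<dots> = 2 * int (n choose 2) + 2 * int n + 2 * (int n * int n) + 2 * int (tri (int n - int k))"
    unfolding two_choose_two two_tri by (simp add: algebra_simps)
  also have "\<dots> = 2 * int ((n choose 2) + n + n * n + tri (int n - int k))"
    by simp
  finally show ?thesis
    unfolding mult_cancel_left of_nat_eq_iff by simp
qed

text \<open>
  The \<open>q\<close>-binomial theorem for \<open>2n + 1\<close> factors with \<open>x = 1\<close>, \<open>y = q\<^sup>n\<close>: the factors below and above
  the middle one, which is \<open>2 q\<^sup>n\<close>, are powers of \<open>q\<close> times the same product of the \<open>1 + q\<^sup>i\<close>.
\<close>

theorem finite_gauss_triangular:
  fixes q :: "'a :: idom"
  assumes "q \<noteq> 0"
  shows "(\<Sum>k\<le>2 * n + 1. q ^ tri (int n - int k) * qbinom q (2 * n + 1) k) =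
         2 * (\<Prod>i<n. 1 + q ^ Suc i) ^ 2"
proof -
  let ?A = "(n choose 2) + n + n * n"
  have "q ^ ?A * (\<Sum>k\<le>2 * n + 1. q ^ tri (int n - int k) * qbinom q (2 * n + 1) k) =
      (\<Sum>k\<le>2 * n + 1. q ^ (?A + tri (int n - int k)) * qbinom q (2 * n + 1) k)"
    by (simp add: sum_distrib_left power_add mult_ac del: sum.atMost_Suc)
  also have "\<dots> = (\<Sum>k\<le>2 * n + 1. q ^ (k choose 2) * qbinom q (2 * n + 1) k * 1 ^ k * (q ^ n) ^ (2 * n + 1 - k))"
    by (intro sum.cong refl) (auto simp: power_add mult_ac simp flip: odd_row_exponent power_mult)
  also have "\<dots> = (\<Prod>i<2 * n + 1. q ^ n + 1 * q ^ i)"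
    by (rule qbinomial_theorem[symmetric])
  also have "\<dots> = (\<Prod>i<n. q ^ n + 1 * q ^ i) * (\<Prod>i<Suc n. q ^ n + q ^ (n + i))"
    using prod_lessThan_add[of "\<lambda>i. q ^ n + q ^ i" n "Suc n"] by (simp add: mult_2)
  also have "(\<Prod>i<n. q ^ n + 1 * q ^ i) = q ^ (n choose 2) * (\<Prod>i<n. 1 + q ^ Suc i)"
    unfolding prod_lower_half by (simp add: add.commute)
  also have "(\<Prod>i<Suc n. q ^ n + q ^ (n + i)) = 2 * q ^ n * (\<Prod>i<n. q ^ n * (1 + q ^ Suc i))"
    by (simp add: prod.lessThan_Suc_shift power_add algebra_simps del: prod.lessThan_Suc)
  also have "q ^ (n choose 2) * (\<Prod>i<n. 1 + q ^ Suc i) * (2 * q ^ n * (\<Prod>i<n. q ^ n * (1 + q ^ Suc i)))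
    = q ^ ?A * (2 * (\<Prod>i<n. 1 + q ^ Suc i) ^ 2)"
    by (simp add: prod.distrib power_add power2_eq_square mult_ac flip: power_mult)
  finally show ?thesis
    using assms by simp
qed

lemma qbinom_const_poly: "qbinom [:q:] n k = [:qbinom q n k:]"
  by (induction q n k rule: qbinom.induct) (simp_all add: one_pCons poly_const_pow mult.commute del: power_Suc)

text \<open>
  The \<open>q\<close>-binomial theorem for \<open>2n + 1\<close> factors with \<open>x = - 1\<close> has a zero at \<open>y = q\<^sup>n\<close>. The derivative
  in \<open>y\<close> there is the product \<open>Q\<close> of the other factors, hence a power of \<open>q\<close> times \<open>\<plusminus> (q; q)\<^sub>n\<^sup>2\<close>. On the
  side of the sum it brings down the exponent \<open>2n + 1 - k\<close> of \<open>y\<close>. Twice \<open>q\<^sup>n\<close> times the derivative,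
  minus \<open>2n + 1\<close> times the vanishing value, has the weight \<open>2n + 1 - 2k\<close>, which is \<open>2m + 1\<close>
  for \<open>m = n - k\<close>.
\<close>

theorem finite_jacobi_cube:
  fixes q :: "'a :: idom"
  assumes "q \<noteq> 0"
  shows "(\<Sum>k\<le>2 * n + 1. of_int (sgn_pow (int n - int k) * (2 * (int n - int k) + 1)) *
           q ^ tri (int n - int k) * qbinom q (2 * n + 1) k) = 2 * qpoch q n ^ 2"
proof -
  let ?A = "(n choose 2) + n + n * n" and ?N = "2 * n + 1"
  define c where "c = (\<lambda>k. q ^ (k choose 2) * qbinom q ?N k * (- 1) ^ k)"
  define P where "P = (\<Prod>i<?N. [:- (q ^ i), 1:])"
  \<comment> \<open>The factors other than the one that vanishes at \<open>q ^ n\<close>.\<close>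
  define Q where "Q = (\<Prod>i<n. [:- (q ^ i), 1:]) * (\<Prod>i<n. [:- (q ^ (n + Suc i)), 1:])"
  have "P = (\<Prod>i<?N. [:0, 1:] + [:- 1:] * [:q:] ^ i)"
    by (simp add: P_def poly_const_pow)
  also have "\<dots> = (\<Sum>k\<le>?N. [:q:] ^ (k choose 2) * qbinom [:q:] ?N k * [:- 1:] ^ k * [:0, 1:] ^ (?N - k))"
    by (rule qbinomial_theorem)
  also have "\<dots> = (\<Sum>k\<le>?N. monom (c k) (?N - k))"
    by (intro sum.cong refl) (simp add: c_def qbinom_const_poly poly_const_pow monom_altdef mult_ac)
  finally have P_sum: "P = (\<Sum>k\<le>?N. monom (c k) (?N - k))" .
  have N: "?N = n + Suc n"
    by simp
  have "P = (\<Prod>i<n. [:- (q ^ i), 1:]) * (\<Prod>i<Suc n. [:- (q ^ (n + i)), 1:])"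
    unfolding P_def N by (rule prod_lessThan_add)
  also have "(\<Prod>i<Suc n. [:- (q ^ (n + i)), 1:]) = [:- (q ^ n), 1:] * (\<Prod>i<n. [:- (q ^ (n + Suc i)), 1:])"
    by (simp only: prod.lessThan_Suc_shift add_0_right o_def)
  finally have P_Q: "P = [:- (q ^ n), 1:] * Q"
    unfolding Q_def by (simp only: mult_ac)

  have "poly Q (q ^ n) = (\<Prod>i<n. q ^ n - q ^ i) * (\<Prod>i<n. q ^ n - q ^ (n + Suc i))"
    by (simp add: Q_def poly_prod)
  also have "(\<Prod>i<n. q ^ n - q ^ i) = q ^ (n choose 2) * (\<Prod>i<n. q ^ Suc i - 1)"
    using prod_lower_half[of q n "- 1"] by simp
  also have "(\<Prod>i<n. q ^ Suc i - 1) = (- 1) ^ n * qpoch q n"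
    by (induction n) (simp_all add: qpoch_Suc algebra_simps)
  also have "(\<Prod>i<n. q ^ n - q ^ (n + Suc i)) = (\<Prod>i<n. q ^ n * (1 - q ^ Suc i))"
    by (simp add: right_diff_distrib power_add mult_ac)
  also have "\<dots> = q ^ (n * n) * qpoch q n"
    by (simp only: prod.distrib qpoch_def prod_constant card_lessThan power_mult)
  finally have "poly Q (q ^ n) = (- 1) ^ n * q ^ ((n choose 2) + n * n) * qpoch q n ^ 2"
    by (simp only: power_add power2_eq_square mult_ac)
  then have Q': "2 * (q ^ n * poly Q (q ^ n)) = (- 1) ^ n * q ^ ?A * (2 * qpoch q n ^ 2)"
    by (simp only: power_add mult_ac)

  have "q ^ n * poly Q (q ^ n) = q ^ n * poly (pderiv P) (q ^ n)"
    unfolding P_Q pderiv_mult by (simp add: pderiv_pCons del: mult_pCons_left)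
  also have "\<dots> = (\<Sum>k\<le>?N. of_nat (?N - k) * c k * (q ^ n) ^ (?N - k))"
  proof -
    have "q ^ n * poly (pderiv (monom (c k) j)) (q ^ n) = of_nat j * c k * (q ^ n) ^ j" for k j
      by (cases j) (simp_all add: pderiv_monom poly_monom mult_ac)
    moreover have "pderiv (\<Sum>k\<in>K. p k) = (\<Sum>k\<in>K. pderiv (p k))" for K :: "nat set" and p :: "nat \<Rightarrow> 'a poly"
      by (induction K rule: infinite_finite_induct) (simp_all add: pderiv_add)
    ultimately show ?thesis
      by (simp add: P_sum poly_sum sum_distrib_left del: sum.atMost_Suc)
  qed
  finally have D: "q ^ n * poly Q (q ^ n) = \<dots>" .
  have Z: "(\<Sum>k\<le>?N. c k * (q ^ n) ^ (?N - k)) = 0"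
    using arg_cong[OF P_sum, of "\<lambda>p. poly p (q ^ n)"] by (simp add: P_Q poly_sum poly_monom del: sum.atMost_Suc)
  have "2 * (q ^ n * poly Q (q ^ n)) = 2 * (\<Sum>k\<le>?N. of_nat (?N - k) * c k * (q ^ n) ^ (?N - k)) -
      of_nat ?N * (\<Sum>k\<le>?N. c k * (q ^ n) ^ (?N - k))"
    by (simp only: D Z) simp
  also have "\<dots> = (\<Sum>k\<le>?N. (2 * of_nat (?N - k) - of_nat ?N) * (c k * (q ^ n) ^ (?N - k)))"
    by (simp add: sum_distrib_left sum_subtractf algebra_simps del: sum.atMost_Suc)
  also have "\<dots> = (\<Sum>k\<le>?N. (- 1) ^ n * q ^ ?A * (of_int (sgn_pow (int n - int k) * (2 * (int n - int k) + 1)) *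
           q ^ tri (int n - int k) * qbinom q ?N k))"
  proof (intro sum.cong refl)
    fix k assume "k \<in> {..?N}"
    then have k: "k \<le> ?N" by simp
    have "q ^ (k choose 2) * (q ^ n) ^ (?N - k) = q ^ ?A * q ^ tri (int n - int k)"
      unfolding power_mult[symmetric] power_add[symmetric] odd_row_exponent[OF k] ..
    moreover have "2 * of_nat (?N - k) - of_nat ?N = (of_int (2 * (int n - int k) + 1) :: 'a)"
      using k by (simp add: of_nat_diff algebra_simps)
    moreover have "(2 * of_nat (?N - k) - of_nat ?N) * (c k * (q ^ n) ^ (?N - k)) =
        (2 * of_nat (?N - k) - of_nat ?N) * ((- 1) ^ n * of_int (sgn_pow (int n - int k))) *
        qbinom q ?N k * (q ^ (k choose 2) * (q ^ n) ^ (?N - k))"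
      unfolding c_def minus_one_power_eq_sgn_pow[of k n] by (simp only: mult_ac)
    ultimately show "(2 * of_nat (?N - k) - of_nat ?N) * (c k * (q ^ n) ^ (?N - k)) =
        (- 1) ^ n * q ^ ?A * (of_int (sgn_pow (int n - int k) * (2 * (int n - int k) + 1)) *
           q ^ tri (int n - int k) * qbinom q ?N k)"
      by (simp only: of_int_mult mult_ac)
  qed
  finally show ?thesis
    unfolding Q' sum_distrib_left[symmetric] using assms by (simp del: sum.atMost_Suc)
qed

text \<open>
  The \<open>q\<close>-binomial theorem with \<open>q\<^sup>2\<close> for \<open>q\<close>, for \<open>2n\<close> factors with \<open>x = - q\<close> and \<open>y = q\<^bsup>2n\<^esup>\<close>. The
  exponents \<open>2i + 1\<close> of \<open>x (q\<^sup>2)\<^sup>i\<close> lie symmetrically around \<open>2n\<close>, so both halves of the product give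
  the odd factors.
\<close>

theorem finite_gauss_square:
  fixes q :: "'a :: idom"
  assumes "q \<noteq> 0"
  shows "(\<Sum>k\<le>2 * n. of_int (sgn_pow (int n - int k)) *
            q ^ nat ((int n - int k) ^ 2) * qbinom (q ^ 2) (2 * n) k) =
         (\<Prod>i<n. 1 - q ^ (2 * i + 1)) ^ 2"
proof -
  let ?R = "\<Prod>i<n. 1 - q ^ (2 * i + 1)"
  have expo: "2 * (k choose 2) + k + 2 * n * (2 * n - k) = 3 * n * n + nat ((int n - int k) ^ 2)"
    if "k \<le> 2 * n" for k
  proof -
    have "int (2 * (k choose 2) + k + 2 * n * (2 * n - k)) =
        2 * int (k choose 2) + int k + 2 * int n * (2 * int n - int k)"
      using that by (simp add: of_nat_diff)
    also have "\<dots> = 3 * int n * int n + (int n - int k) ^ 2"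
      unfolding two_choose_two by (simp add: algebra_simps power2_eq_square)
    also have "\<dots> = int (3 * n * n + nat ((int n - int k) ^ 2))"
      by simp
    finally show ?thesis
      by linarith
  qed
  have "(- 1) ^ n * q ^ (3 * n * n) * (\<Sum>k\<le>2 * n. of_int (sgn_pow (int n - int k)) *
          q ^ nat ((int n - int k) ^ 2) * qbinom (q ^ 2) (2 * n) k) =
      (\<Sum>k\<le>2 * n. (q ^ 2) ^ (k choose 2) * qbinom (q ^ 2) (2 * n) k * (- q) ^ k * (q ^ (2 * n)) ^ (2 * n - k))"
    unfolding sum_distrib_left
  proof (intro sum.cong refl)
    fix k assume "k \<in> {..2 * n}"
    then have "(q ^ 2) ^ (k choose 2) * q ^ k * (q ^ (2 * n)) ^ (2 * n - k)
        = q ^ (3 * n * n) * q ^ nat ((int n - int k) ^ 2)"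
      unfolding power_mult[symmetric] power_add[symmetric] by (subst expo) auto
    moreover have m: "(- q) ^ k = (- 1) ^ n * of_int (sgn_pow (int n - int k)) * q ^ k"
      unfolding minus_one_power_eq_sgn_pow[symmetric] by (rule power_minus)
    moreover have "(q ^ 2) ^ (k choose 2) * qbinom (q ^ 2) (2 * n) k * (- q) ^ k * (q ^ (2 * n)) ^ (2 * n - k) =
        qbinom (q ^ 2) (2 * n) k * (- 1) ^ n * of_int (sgn_pow (int n - int k)) *
        ((q ^ 2) ^ (k choose 2) * q ^ k * (q ^ (2 * n)) ^ (2 * n - k))"
      unfolding m by (simp only: mult_ac)
    ultimately show "(- 1) ^ n * q ^ (3 * n * n) * (of_int (sgn_pow (int n - int k)) *
          q ^ nat ((int n - int k) ^ 2) * qbinom (q ^ 2) (2 * n) k) =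
        (q ^ 2) ^ (k choose 2) * qbinom (q ^ 2) (2 * n) k * (- q) ^ k * (q ^ (2 * n)) ^ (2 * n - k)"
      by (simp only: mult_ac)
  qed
  also have "\<dots> = (\<Prod>i<2 * n. q ^ (2 * n) + (- q) * (q ^ 2) ^ i)"
    by (rule qbinomial_theorem[symmetric])
  also have "\<dots> = (\<Prod>i<n. q ^ (2 * n) - q ^ (2 * i + 1)) * (\<Prod>i<n. q ^ (2 * n) - q ^ (2 * (n + i) + 1))"
    using prod_lessThan_add[of "\<lambda>i. q ^ (2 * n) - q ^ (2 * i + 1)" n n] by (simp add: mult_2[of n, symmetric] power_mult)
  also have "(\<Prod>i<n. q ^ (2 * n) - q ^ (2 * i + 1)) = (- 1) ^ n * q ^ (n * n) * ?R"
  proof -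
    have "(\<Prod>i<n. q ^ (2 * n) - q ^ (2 * i + 1)) = (\<Prod>i<n. q ^ (2 * n) - q ^ (2 * (n - Suc i) + 1))"
      by (rule prod.nat_diff_reindex[symmetric])
    also have "\<dots> = (\<Prod>i<n. (- 1) * (q ^ (2 * (n - Suc i) + 1) * (1 - q ^ (2 * i + 1))))"
    proof (intro prod.cong refl)
      fix i assume "i \<in> {..<n}"
      then have "2 * n = (2 * (n - Suc i) + 1) + (2 * i + 1)" by auto
      then have "q ^ (2 * n) = q ^ (2 * (n - Suc i) + 1) * q ^ (2 * i + 1)"
        by (metis power_add)
      then show "q ^ (2 * n) - q ^ (2 * (n - Suc i) + 1) =
          (- 1) * (q ^ (2 * (n - Suc i) + 1) * (1 - q ^ (2 * i + 1)))"
        by (simp only:) (simp add: algebra_simps)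
    qed
    also have "\<dots> = (- 1) ^ n * (\<Prod>i<n. q ^ (2 * (n - Suc i) + 1)) * ?R"
      by (simp only: prod.distrib prod_constant card_lessThan mult.assoc)
    also have "(\<Prod>i<n. q ^ (2 * (n - Suc i) + 1)) = (\<Prod>i<n. q ^ (2 * i + 1))"
      by (rule prod.nat_diff_reindex)
    also have "(\<Prod>i<n. q ^ (2 * i + 1)) = q ^ (n * n)"
      by (induction n) (simp_all add: power_add mult_2 mult_2_right mult_ac)
    finally show ?thesis .
  qed
  also have "(\<Prod>i<n. q ^ (2 * n) - q ^ (2 * (n + i) + 1)) = (\<Prod>i<n. q ^ (2 * n) * (1 - q ^ (2 * i + 1)))"
    by (simp add: algebra_simps power_add)
  also have "\<dots> = q ^ (2 * n * n) * ?R"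
    by (simp add: prod.distrib power_mult)
  also have "(- 1) ^ n * q ^ (n * n) * ?R * (q ^ (2 * n * n) * ?R) = (- 1) ^ n * q ^ (3 * n * n) * ?R ^ 2"
    by (simp add: power2_eq_square mult_ac flip: power_add)
  finally show ?thesis
    using assms by simp
qed

section \<open>Series with terms indexed by an arbitrary set\<close>

text \<open>
  The formal sum of \<open>c i * q\<^bsup>e i\<^esup>\<close> over \<open>i \<in> I\<close>. It is meant for exponents \<open>e\<close> that take every value
  finitely often; an infinite fibre contributes \<open>0\<close>. Keeping the index set explicit turns the
  selection of exponents in a residue class into a restriction of \<open>I\<close>.
\<close>

definition theta_series :: "'i set \<Rightarrow> ('i \<Rightarrow> int) \<Rightarrow> ('i \<Rightarrow> nat) \<Rightarrow> int fps" where
  "theta_series I c e = Abs_fps (\<lambda>N. \<Sum>i\<in>{i \<in> I. e i = N}. c i)"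

lemma theta_series_nth: "fps_nth (theta_series I c e) N = (\<Sum>i\<in>{i \<in> I. e i = N}. c i)"
  by (simp add: theta_series_def)

lemma theta_series_cong:
  assumes "I = J" "\<And>i. i \<in> J \<Longrightarrow> c i = d i" "\<And>i. i \<in> J \<Longrightarrow> e i = e' i"
  shows "theta_series I c e = theta_series J d e'"
  unfolding theta_series_def using assms by (intro arg_cong[of _ _ Abs_fps] ext sum.cong) auto

lemma theta_series_scale: "theta_series I (\<lambda>i. a * c i) e = fps_const a * theta_series I c e"
  by (simp add: fps_eq_iff theta_series_nth sum_distrib_left)

lemma X_mult_theta_series: "fps_X * theta_series I c e = theta_series I c (\<lambda>i. Suc (e i))"
proof (rule fps_ext)
  fix n
  show "fps_nth (fps_X * theta_series I c e) n = fps_nth (theta_series I c (\<lambda>i. Suc (e i))) n"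
    by (cases n) (simp_all add: theta_series_nth)
qed

lemma theta_series_reindex:
  assumes "inj_on h I"
  shows "theta_series (h ` I) c e = theta_series I (\<lambda>i. c (h i)) (\<lambda>i. e (h i))"
proof (rule fps_ext)
  fix N
  have "{i \<in> h ` I. e i = N} = h ` {i \<in> I. e (h i) = N}"
    by auto
  moreover have "inj_on h {i \<in> I. e (h i) = N}"
    using assms by (rule inj_on_subset) auto
  ultimately show "fps_nth (theta_series (h ` I) c e) N = fps_nth (theta_series I (\<lambda>i. c (h i)) (\<lambda>i. e (h i))) N"
    by (simp add: theta_series_nth sum.reindex)
qed

lemma theta_series_mult:
  assumes I: "\<And>N. finite {i \<in> I. e i = N}" and J: "\<And>N. finite {j \<in> J. e' j = N}"
  shows "theta_series I c e * theta_series J d e' =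
    theta_series (I \<times> J) (\<lambda>(i, j). c i * d j) (\<lambda>(i, j). e i + e' j)"
proof (rule fps_ext)
  fix N
  let ?F = "\<lambda>s. {i \<in> I. e i = s} \<times> {j \<in> J. e' j = N - s}"
  have "fps_nth (theta_series I c e * theta_series J d e') N = (\<Sum>s\<in>{0..N}. \<Sum>(i, j)\<in>?F s. c i * d j)"
    by (simp add: fps_mult_nth theta_series_nth sum_product sum.cartesian_product)
  also have "\<dots> = (\<Sum>(i, j)\<in>(\<Union>s\<in>{0..N}. ?F s). c i * d j)"
    using I J by (intro sum.UNION_disjoint[symmetric]) auto
  also have "(\<Union>s\<in>{0..N}. ?F s) = {p \<in> I \<times> J. (case p of (i, j) \<Rightarrow> e i + e' j) = N}"
    by auto
  finally show "fps_nth (theta_series I c e * theta_series J d e') N =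
      fps_nth (theta_series (I \<times> J) (\<lambda>(i, j). c i * d j) (\<lambda>(i, j). e i + e' j)) N"
    by (simp add: theta_series_nth)
qed

text \<open>
  The termwise limit: if each \<open>g k\<close> is close to \<open>1 / F\<close>, then \<open>F\<close> times the finite sum is close to the
  full series. The factor \<open>g k\<close> need only be accurate up to the order that its monomial leaves open,
  which matters since the outer \<open>q\<close>-binomial coefficients of a row are far from the limit.
\<close>

lemma theta_series_limit:
  assumes K: "finite K" "inj_on h K" and out: "\<And>i. i \<notin> h ` K \<Longrightarrow> N \<le> e i"
    and g: "\<And>k. k \<in> K \<Longrightarrow> fps_X ^ (N - e (h k)) dvd F * g k - 1"
  shows "fps_X ^ N dvd F * (\<Sum>k\<in>K. of_int (c (h k)) * fps_X ^ e (h k) * g k) - theta_series UNIV c e"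
proof -
  let ?t = "\<lambda>k. of_int (c (h k)) * fps_X ^ e (h k) :: int fps"
  have "fps_X ^ N dvd ?t k * (F * g k - 1)" if "k \<in> K" for k
  proof -
    have "fps_X ^ N dvd (fps_X ^ e (h k) * fps_X ^ (N - e (h k)) :: int fps)"
      unfolding power_add[symmetric] by (rule le_imp_power_dvd) simp
    also have "\<dots> dvd fps_X ^ e (h k) * (F * g k - 1)"
      using g[OF that] by (rule mult_dvd_mono[OF dvd_refl])
    finally show ?thesis
      by (simp add: mult.assoc)
  qed
  then have "fps_X ^ N dvd (\<Sum>k\<in>K. ?t k * (F * g k - 1))"
    by (rule dvd_sum)
  also have "(\<Sum>k\<in>K. ?t k * (F * g k - 1)) = F * (\<Sum>k\<in>K. ?t k * g k) - (\<Sum>k\<in>K. ?t k)"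
    by (simp add: algebra_simps sum_subtractf sum_distrib_left)
  finally have 1: "fps_X ^ N dvd F * (\<Sum>k\<in>K. ?t k * g k) - (\<Sum>k\<in>K. ?t k)" .
  have "fps_nth (\<Sum>k\<in>K. ?t k) m = fps_nth (theta_series UNIV c e) m" if m: "m < N" for m
  proof -
    have "fps_nth (\<Sum>k\<in>K. ?t k) m = (\<Sum>k\<in>K. if m = e (h k) then c (h k) else 0)"
      by (simp add: fps_sum_nth fps_of_int[symmetric] fps_X_power_nth if_distrib cong: if_cong)
    also have "\<dots> = (\<Sum>i\<in>h ` K. if m = e i then c i else 0)"
      using K(2) by (simp add: sum.reindex)
    also have "\<dots> = (\<Sum>i\<in>{i \<in> h ` K. e i = m}. c i)"
      using K(1) by (subst sum.inter_filter) (auto intro!: sum.cong)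
    also have "{i \<in> h ` K. e i = m} = {i \<in> UNIV. e i = m}"
      using out m by (metis (no_types, lifting) Collect_cong UNIV_I leD)
    finally show ?thesis
      by (simp add: theta_series_nth)
  qed
  then have "fps_X ^ N dvd (\<Sum>k\<in>K. ?t k) - theta_series UNIV c e"
    by (simp add: fps_X_power_dvd_iff_nth)
  with 1 show ?thesis
    by (rule dvd_cong_trans)
qed

section \<open>The identities of Gauss and Jacobi\<close>

text \<open>
  The theta functions \<open>\<psi>(q\<^sup>k)\<close> (doubled) and \<open>\<phi>(- q\<^sup>k)\<close> of Ramanujan, and Jacobi's series for the cube
  of the Euler product (doubled).
\<close>

definition psi :: "nat \<Rightarrow> int fps" where
  "psi k = theta_series UNIV (\<lambda>_. 1) (\<lambda>m. k * tri m)"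

definition phi :: "nat \<Rightarrow> int fps" where
  "phi k = theta_series UNIV sgn_pow (\<lambda>m. k * nat (m ^ 2))"

definition jac :: "nat \<Rightarrow> int fps" where
  "jac k = theta_series UNIV (\<lambda>m. sgn_pow m * (2 * m + 1)) (\<lambda>m. k * tri m)"

lemma abs_le_Suc_tri: "\<bar>m\<bar> \<le> int (tri m) + 1"
proof -
  have "(m - 1) * (m - 2) \<ge> 0" "(m + 1) * (m + 2) \<ge> 0"
    by (simp_all add: zero_le_mult_iff) linarith+
  then show ?thesis
    using two_tri[of m] by (simp add: algebra_simps abs_le_iff)
qed

lemma abs_le_square_int: "\<bar>m\<bar> \<le> m ^ 2" for m :: int
proof (cases "m = 0")
  case False
  then have "\<bar>m\<bar> * 1 \<le> \<bar>m\<bar> * \<bar>m\<bar>"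
    by (intro mult_left_mono) auto
  then show ?thesis
    by (simp add: power2_eq_square flip: abs_mult)
qed simp

lemma finite_tri_fibre: "k > 0 \<Longrightarrow> finite {m. k * tri m = N}"
proof -
  assume k: "k > 0"
  have "{m. k * tri m = N} \<subseteq> {- int N - 1..int N + 1}"
  proof
    fix m assume "m \<in> {m. k * tri m = N}"
    then have "tri m \<le> N" using k by auto
    then show "m \<in> {- int N - 1..int N + 1}"
      using abs_le_Suc_tri[of m] by auto
  qed
  then show ?thesis by (rule finite_subset) simp
qed

lemma finite_square_fibre: "k > 0 \<Longrightarrow> finite {m. k * nat (m ^ 2) = N}"
proof -
  assume k: "k > 0"
  have "{m. k * nat (m ^ 2) = N} \<subseteq> {- int N..int N}"
  proof
    fix m assume "m \<in> {m. k * nat (m ^ 2) = N}"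
    then have "nat (m ^ 2) \<le> N" using k by auto
    then show "m \<in> {- int N..int N}"
      using abs_le_square_int[of m] by auto
  qed
  then show ?thesis by (rule finite_subset) simp
qed

text \<open>
  For the term with distance \<open>m\<close> from the middle, the \<open>q\<close>-binomial coefficient is accurate up to order
  about \<open>n - \<bar>m\<bar>\<close>, and the triangular exponent makes up for the missing \<open>\<bar>m\<bar>\<close>.
\<close>

lemma odd_row_limit:
  assumes k: "k > 0"
  shows "fps_X ^ Suc n dvd euler_prod k * (\<Sum>j\<le>2 * n + 1. of_int (c (int n - int j)) *
      (fps_X ^ k) ^ tri (int n - int j) * qbinom (fps_X ^ k) (2 * n + 1) j) - theta_series UNIV c (\<lambda>m. k * tri m)"
  unfolding power_mult[symmetric]
proof (rule theta_series_limit)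
  show "inj_on (\<lambda>j. int n - int j) {..2 * n + 1}"
    by (auto simp: inj_on_def)
next
  fix m :: int
  assume m: "m \<notin> (\<lambda>j. int n - int j) ` {..2 * n + 1}"
  \<comment> \<open>The index \<open>- int n - 1\<close> still belongs to the row, whereas \<open>int n + 1\<close> does not.\<close>
  have "\<bar>m\<bar> > int n + 1 \<or> m = int n + 1"
  proof (rule ccontr)
    assume *: "\<not> ?thesis"
    then have "m = int n - int (nat (int n - m))" "nat (int n - m) \<le> 2 * n + 1"
      by auto
    with m show False by blast
  qed
  then have "int (Suc n) \<le> int (tri m)"
  proof
    assume m: "m = int n + 1"
    have "2 * int (Suc n) \<le> 2 * int (tri m)"
      unfolding two_tri m by (simp add: algebra_simps)
    then show ?thesis by simp
  qed (use abs_le_Suc_tri[of m] in linarith)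
  also have "\<dots> \<le> int (k * tri m)"
    using k mult_right_mono[of 1 k "tri m"] by (simp del: of_nat_mult)
  finally show "Suc n \<le> k * tri m" by linarith
next
  fix j assume "j \<in> {..2 * n + 1}"
  then have j: "j \<le> 2 * n + 1" by simp
  define m where "m = int n - int j"
  have t: "\<bar>m\<bar> \<le> int (tri m) + 1" "m \<le> int (tri m)"
    using abs_le_Suc_tri[of m] abs_le_square_int[of m] two_tri[of m]
    by (simp_all add: power2_eq_square algebra_simps)
  have "Suc n - k * tri m \<le> Suc n - tri m"
    using k by (intro diff_le_mono2) auto
  also have "Suc n - tri m \<le> min (Suc j) (Suc (2 * n + 1 - j))"
    using t j unfolding m_def by linarith
  also have "\<dots> \<le> k * min (Suc j) (Suc (2 * n + 1 - j))"
    using k mult_right_mono[of 1 k "min (Suc j) (Suc (2 * n + 1 - j))"] by simp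
  finally have N: "Suc n - k * tri m \<le> k * Suc (2 * n + 1 - j)" "Suc n - k * tri m \<le> k * Suc j"
    by (meson dual_order.trans min.cobounded1 min.cobounded2 mult_le_mono2)+
  show "fps_X ^ (Suc n - k * tri (int n - int j)) dvd
      euler_prod k * qbinom (fps_X ^ k) (2 * n + 1) j - 1"
    using euler_prod_mult_qbinom[OF k N] j by (simp add: m_def)
qed simp

lemma even_row_limit:
  assumes k: "k > 0"
  shows "fps_X ^ Suc n dvd euler_prod (2 * k) * (\<Sum>j\<le>2 * n. of_int (c (int n - int j)) *
      (fps_X ^ k) ^ nat ((int n - int j) ^ 2) * qbinom (fps_X ^ (2 * k)) (2 * n) j) -
      theta_series UNIV c (\<lambda>m. k * nat (m ^ 2))"
  unfolding power_mult[symmetric]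
proof (rule theta_series_limit)
  show "inj_on (\<lambda>j. int n - int j) {..2 * n}"
    by (auto simp: inj_on_def)
next
  fix m :: int
  assume m: "m \<notin> (\<lambda>j. int n - int j) ` {..2 * n}"
  have "\<bar>m\<bar> \<ge> int (Suc n)"
  proof (rule ccontr)
    assume *: "\<not> ?thesis"
    then have "m = int n - int (nat (int n - m))" "nat (int n - m) \<le> 2 * n"
      by auto
    with m show False by blast
  qed
  also have "\<bar>m\<bar> \<le> m ^ 2"
    by (rule abs_le_square_int)
  also have "m ^ 2 \<le> int (k * nat (m ^ 2))"
    using k mult_right_mono[of 1 "int k" "m ^ 2"] by simp
  finally show "Suc n \<le> k * nat (m ^ 2)" by linarith
next
  fix j assume "j \<in> {..2 * n}"
  then have j: "j \<le> 2 * n" by simp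
  define m where "m = int n - int j"
  have t: "\<bar>m\<bar> \<le> int (nat (m ^ 2))"
    using abs_le_square_int[of m] by simp
  have "Suc n - k * nat (m ^ 2) \<le> Suc n - nat (m ^ 2)"
    using k by (intro diff_le_mono2) auto
  also have "Suc n - nat (m ^ 2) \<le> min (Suc j) (Suc (2 * n - j))"
    using t j unfolding m_def by linarith
  also have "\<dots> \<le> 2 * k * min (Suc j) (Suc (2 * n - j))"
    using k mult_right_mono[of 1 "2 * k" "min (Suc j) (Suc (2 * n - j))"] by simp
  finally have N: "Suc n - k * nat (m ^ 2) \<le> 2 * k * Suc (2 * n - j)" "Suc n - k * nat (m ^ 2) \<le> 2 * k * Suc j"
    by (meson dual_order.trans min.cobounded1 min.cobounded2 mult_le_mono2)+
  have "2 * k > 0" using k by simp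
  from euler_prod_mult_qbinom[OF this N] j
  show "fps_X ^ (Suc n - k * nat ((int n - int j) ^ 2)) dvd
      euler_prod (2 * k) * qbinom (fps_X ^ (2 * k)) (2 * n) j - 1"
    by (simp add: m_def)
qed simp

lemma euler_prod_cong:
  assumes "k > 0" "N \<le> k * Suc n"
  shows "fps_X ^ N dvd euler_prod k - qpoch (fps_X ^ k) n"
  using qpoch_cong_euler_prod[OF assms(1), of n] assms(2)
  by (metis dvd_cong_sym dvd_trans le_imp_power_dvd)

text \<open>
  Jacobi's identity: \<open>finite_jacobi_cube\<close> multiplied by \<open>f\<^sub>k\<close>, which cancels the limit of the
  \<open>q\<close>-binomial coefficients.
\<close>

theorem jac_eq:
  assumes k: "k > 0"
  shows "jac k = 2 * euler_prod k ^ 3"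
proof (rule fps_eq_if_X_power_dvd)
  fix N
  let ?q = "fps_X ^ k :: int fps"
  have "fps_X ^ Suc N dvd euler_prod k * (2 * qpoch ?q N ^ 2) - jac k"
    using odd_row_limit[OF k, of N "\<lambda>m. sgn_pow m * (2 * m + 1)"] finite_jacobi_cube[of ?q N]
    unfolding jac_def by simp
  then have 1: "fps_X ^ N dvd euler_prod k * (2 * qpoch ?q N ^ 2) - jac k"
    by (rule power_le_dvd) simp
  have "N \<le> k * Suc N"
    using k by (cases k) auto
  then have "fps_X ^ N dvd euler_prod k - qpoch ?q N"
    by (rule euler_prod_cong[OF k])
  then have "fps_X ^ N dvd euler_prod k * (2 * (euler_prod k * euler_prod k)) -
      euler_prod k * (2 * (qpoch ?q N * qpoch ?q N))"
    by (intro dvd_cong_mult) auto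
  from dvd_cong_sym[OF dvd_cong_trans[OF this 1[unfolded power2_eq_square]]]
  show "fps_X ^ N dvd jac k - 2 * euler_prod k ^ 3"
    by (simp add: power3_eq_cube mult_ac)
qed

text \<open>
  Gauss's identity for triangular numbers. One factor \<open>f\<^sub>k\<close> cancels the limit of the \<open>q\<close>-binomial
  coefficients in \<open>finite_gauss_triangular\<close>; one for each of the two products of the \<open>1 + q\<^sup>i\<close> turns it
  into \<open>f\<^bsub>2k\<^esub>\<close>.
\<close>

theorem psi_eq:
  assumes k: "k > 0"
  shows "euler_prod k * psi k = 2 * euler_prod (2 * k) ^ 2"
proof (rule fps_eq_if_X_power_dvd)
  fix N
  let ?q = "fps_X ^ k :: int fps" and ?f = "euler_prod k"
  let ?R = "\<Prod>i<N. 1 + ?q ^ Suc i"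
  have "fps_X ^ Suc N dvd ?f * (2 * ?R ^ 2) - psi k"
    using odd_row_limit[OF k, of N "\<lambda>_. 1"] finite_gauss_triangular[of ?q N]
    unfolding psi_def by simp
  then have "fps_X ^ N dvd ?f * (2 * ?R ^ 2) - psi k"
    by (rule power_le_dvd) simp
  then have "fps_X ^ N dvd ?f * (?f * (2 * ?R ^ 2)) - ?f * psi k"
    by (intro dvd_cong_mult) auto
  then have 1: "fps_X ^ N dvd 2 * ((?f * ?R) * (?f * ?R)) - ?f * psi k"
    by (simp add: power2_eq_square mult_ac)
  have N: "N \<le> k * Suc N"
    using k by (cases k) auto
  have "fps_X ^ N dvd euler_prod (2 * k) - qpoch (?q ^ 2) N"
    using euler_prod_cong[of "2 * k" N N] N k by (simp add: mult.commute flip: power_mult)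
  moreover have "fps_X ^ N dvd qpoch ?q N * ?R - ?f * ?R"
    using dvd_cong_sym[OF euler_prod_cong[OF k N]] by (intro dvd_cong_mult) auto
  then have "fps_X ^ N dvd qpoch (?q ^ 2) N - ?f * ?R"
    unfolding qpoch_mult_prod_plus .
  ultimately have "fps_X ^ N dvd euler_prod (2 * k) - ?f * ?R"
    by (rule dvd_cong_trans)
  then have "fps_X ^ N dvd 2 * (euler_prod (2 * k) * euler_prod (2 * k)) - 2 * ((?f * ?R) * (?f * ?R))"
    by (intro dvd_cong_mult) auto
  from dvd_cong_sym[OF dvd_cong_trans[OF this 1]] show "fps_X ^ N dvd ?f * psi k - 2 * euler_prod (2 * k) ^ 2"
    by (simp add: power2_eq_square)
qed

text \<open>
  Gauss's identity for squares, from \<open>finite_gauss_square\<close>. The \<open>q\<close>-binomial coefficients are taken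
  at \<open>q\<^sup>2\<close>, so here it is \<open>f\<^bsub>2k\<^esub>\<close> that cancels their limit and completes each product of odd factors to
  \<open>f\<^sub>k\<close>.
\<close>

theorem phi_eq:
  assumes k: "k > 0"
  shows "euler_prod (2 * k) * phi k = euler_prod k ^ 2"
proof (rule fps_eq_if_X_power_dvd)
  fix N
  let ?q = "fps_X ^ k :: int fps" and ?f = "euler_prod (2 * k)"
  let ?R = "\<Prod>i<N. 1 - ?q ^ (2 * i + 1)"
  have q2: "?q ^ 2 = fps_X ^ (2 * k)"
    by (simp add: mult.commute flip: power_mult)
  have "fps_X ^ Suc N dvd ?f * ?R ^ 2 - phi k"
    using even_row_limit[OF k, of N sgn_pow] finite_gauss_square[of ?q N]
    unfolding phi_def q2 by simp
  then have "fps_X ^ N dvd ?f * ?R ^ 2 - phi k"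
    by (rule power_le_dvd) simp
  then have "fps_X ^ N dvd ?f * (?f * ?R ^ 2) - ?f * phi k"
    by (intro dvd_cong_mult) auto
  then have 1: "fps_X ^ N dvd (?f * ?R) * (?f * ?R) - ?f * phi k"
    by (simp add: power2_eq_square mult_ac)
  have N: "N \<le> k * Suc N" "N \<le> k * Suc (2 * N)" "N \<le> 2 * k * Suc N"
    using k by (cases k; auto)+
  have "fps_X ^ N dvd euler_prod k - qpoch ?q (2 * N)"
    using N k by (intro euler_prod_cong) auto
  moreover have "fps_X ^ N dvd qpoch (?q ^ 2) N * ?R - ?f * ?R"
    using dvd_cong_sym[OF euler_prod_cong[of "2 * k" N N]] N k unfolding q2 by (intro dvd_cong_mult) auto
  then have "fps_X ^ N dvd qpoch ?q (2 * N) - ?f * ?R"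
    unfolding qpoch_square_mult_prod_odd .
  ultimately have "fps_X ^ N dvd euler_prod k - ?f * ?R"
    by (rule dvd_cong_trans)
  then have "fps_X ^ N dvd euler_prod k * euler_prod k - (?f * ?R) * (?f * ?R)"
    by (intro dvd_cong_mult)
  from dvd_cong_sym[OF dvd_cong_trans[OF this 1]] show "fps_X ^ N dvd ?f * phi k - euler_prod k ^ 2"
    by (simp add: power2_eq_square)
qed

section \<open>Extraction of the exponents congruent to 4 modulo 5\<close>

definition U5 :: "int fps \<Rightarrow> int fps" where
  "U5 f = Abs_fps (\<lambda>n. fps_nth f (5 * n + 4))"

lemma U5_nth [simp]: "fps_nth (U5 f) n = fps_nth f (5 * n + 4)"
  by (simp add: U5_def)

lemma U5_const_mult: "U5 (fps_const c * f) = fps_const c * U5 f"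
  by (simp add: fps_eq_iff)

lemma eq_5_mult_plus_4_iff: "(x :: nat) = 5 * n + 4 \<longleftrightarrow> x mod 5 = 4 \<and> x div 5 = n"
proof
  assume "x mod 5 = 4 \<and> x div 5 = n"
  then show "x = 5 * n + 4"
    using mult_div_mod_eq[of 5 x] by simp
qed simp

lemma U5_theta_series: "U5 (theta_series I c e) = theta_series {i \<in> I. e i mod 5 = 4} c (\<lambda>i. e i div 5)"
proof (rule fps_ext)
  fix N
  have "{i \<in> I. e i = 5 * N + 4} = {i \<in> {i \<in> I. e i mod 5 = 4}. e i div 5 = N}"
    unfolding eq_5_mult_plus_4_iff by blast
  then show "fps_nth (U5 (theta_series I c e)) N = fps_nth (theta_series {i \<in> I. e i mod 5 = 4} c (\<lambda>i. e i div 5)) N"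
    unfolding U5_nth theta_series_nth by (rule sum.cong) (rule refl)
qed

text \<open>
  If the indices whose exponents are \<open>4\<close> modulo \<open>5\<close> are parametrized by \<open>h\<close>, and \<open>h\<close> multiplies all
  coefficients by \<open>a\<close>, then the extraction gives \<open>a\<close> times a series indexed by the parameters.
\<close>

lemma U5_theta_series_reindex:
  assumes "\<And>i. i \<in> I \<Longrightarrow> e i mod 5 = 4 \<Longrightarrow> i \<in> h ` J" "h ` J \<subseteq> I" "inj_on h J"
    and c: "\<And>j. j \<in> J \<Longrightarrow> c (h j) = a * d j" and e: "\<And>j. j \<in> J \<Longrightarrow> e (h j) = 5 * e' j + 4"
  shows "U5 (theta_series I c e) = fps_const a * theta_series J d e'"
proof -
  have "{i \<in> I. e i mod 5 = 4} = h ` J"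
    using assms(1,2) e by auto
  then have "U5 (theta_series I c e) = theta_series J (\<lambda>j. c (h j)) (\<lambda>j. e (h j) div 5)"
    by (simp add: U5_theta_series theta_series_reindex[OF assms(3)])
  also have "\<dots> = theta_series J (\<lambda>j. a * d j) e'"
    by (rule theta_series_cong) (simp_all add: c e)
  finally show ?thesis
    by (simp add: theta_series_scale)
qed

text \<open>
  A factor in \<open>q\<^sup>5\<close> does not change exponents modulo \<open>5\<close>, so it can be pulled out of \<open>U5\<close>, with \<open>q\<^sup>5\<close>
  replaced by \<open>q\<close>.
\<close>

lemma U5_mult_theta_series_5:
  assumes I: "\<And>N. finite {i \<in> I. e i = N}" and J: "\<And>N. finite {j \<in> J. e' j = N}"
  shows "U5 (theta_series I c e * theta_series J d (\<lambda>j. 5 * e' j)) = U5 (theta_series I c e) * theta_series J d e'"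
proof -
  have J5: "finite {j \<in> J. 5 * e' j = N}" for N
    by (rule finite_subset[OF _ J[of "N div 5"]]) auto
  have I5: "finite {i \<in> {i \<in> I. e i mod 5 = 4}. e i div 5 = N}" for N
    by (rule finite_subset[OF _ I[of "5 * N + 4"]]) (auto simp: eq_5_mult_plus_4_iff)
  show ?thesis
    unfolding theta_series_mult[OF I J5] U5_theta_series theta_series_mult[OF I5 J]
    by (rule theta_series_cong) auto
qed

lemma tri_5_2: "tri (5 * m + 2) = 25 * tri m + 3"
  using two_tri[of m] by (intro tri_eqI) (simp add: algebra_simps)

lemma sgn_pow_5: "sgn_pow (5 * m) = sgn_pow m" "sgn_pow (5 * m + 2) = sgn_pow m"
  by (simp_all add: sgn_pow_def)

lemma mod_5_cases:
  fixes m :: int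
  obtains "m mod 5 = 0" | "m mod 5 = 1" | "m mod 5 = 2" | "m mod 5 = 3" | "m mod 5 = 4"
proof -
  have "m mod 5 \<in> {0..<5}"
    by simp
  also have "{0..<5} = {0, 1, 2, 3, 4 :: int}"
    by auto
  finally have "m mod 5 = 0 \<or> m mod 5 = 1 \<or> m mod 5 = 2 \<or> m mod 5 = 3 \<or> m mod 5 = 4"
    by simp
  then show ?thesis
    using that by metis
qed

text \<open>
  Here \<open>2\<close> is the double root of \<open>m (m + 1) / 2 = 3\<close> modulo \<open>5\<close>: it corresponds to \<open>2m + 1 \<equiv> 0\<close> in
  \<open>8 tri m + 1 = (2m + 1)\<^sup>2\<close>.
\<close>

lemma tri_mod_5:
  "tri m mod 5 = 0 \<and> m mod 5 \<noteq> 2 \<or> tri m mod 5 = 1 \<and> m mod 5 \<noteq> 2 \<or>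
   tri m mod 5 = 3 \<and> m mod 5 = 2"
proof -
  have "int (tri m mod 5) = (int (tri m) + 5 * int (tri m)) mod 5"
    by (simp only: mod_mult_self2 of_nat_mod of_nat_numeral)
  also have "int (tri m) + 5 * int (tri m) = 3 * (m * (m + 1))"
    unfolding two_tri[symmetric] by simp
  also have "\<dots> mod 5 = 3 * ((m mod 5) * ((m mod 5 + 1) mod 5) mod 5) mod 5"
    by (simp only: mod_mult_right_eq mod_mult_left_eq mod_add_left_eq)
  finally have t: "int (tri m mod 5) = \<dots>" .
  show ?thesis
    by (rule mod_5_cases[of m]) (use t in simp_all)
qed

lemma square_mod_5:
  "nat (m ^ 2) mod 5 = 1 \<or> nat (m ^ 2) mod 5 = 4 \<or> nat (m ^ 2) mod 5 = 0 \<and> m mod 5 = 0"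
proof -
  have t: "int (nat (m ^ 2) mod 5) = (m mod 5) * (m mod 5) mod 5"
    by (simp add: of_nat_mod power2_eq_square mod_mult_eq)
  show ?thesis
    by (rule mod_5_cases[of m]) (use t in simp_all)
qed

text \<open>
  The assumption says \<open>(2m + 1)\<^sup>2 + 2 (2l + 1)\<^sup>2 \<equiv> 0\<close> modulo \<open>5\<close>. Since \<open>- 2\<close> is not a square modulo \<open>5\<close>,
  this forces \<open>2m + 1 \<equiv> 2l + 1 \<equiv> 0\<close>.
\<close>

lemma tri_plus_two_tri_mod_5:
  assumes "(tri m + 2 * tri l) mod 5 = 4"
  shows "m mod 5 = 2 \<and> l mod 5 = 2"
proof -
  have "(tri m mod 5 + 2 * (tri l mod 5) mod 5) mod 5 = 4"
    using assms by (simp only: mod_add_eq mod_mult_right_eq)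
  then show ?thesis
    using tri_mod_5[of m] tri_mod_5[of l] by (elim disjE conjE) simp_all
qed

text \<open>
  The assumption says \<open>8 m\<^sup>2 + (2l + 1)\<^sup>2 \<equiv> 0\<close> modulo \<open>5\<close>. Since \<open>- 8 \<equiv> 2\<close> is not a square modulo \<open>5\<close>,
  this forces \<open>m \<equiv> 2l + 1 \<equiv> 0\<close>.
\<close>

lemma square_plus_tri_mod_5:
  assumes "(nat (m ^ 2) + tri l) mod 5 = 3"
  shows "m mod 5 = 0 \<and> l mod 5 = 2"
proof -
  have "(nat (m ^ 2) mod 5 + tri l mod 5) mod 5 = 3"
    using assms by (simp only: mod_add_eq)
  then show ?thesis
    using square_mod_5[of m] tri_mod_5[of l] by (elim disjE conjE) simp_all
qed

section \<open>The fifth powers as theta series of binary forms\<close>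

text \<open>
  These are \<open>4 f\<^bsub>2k\<^esub>\<^sup>5 / f\<^sub>k\<close> and \<open>2 f\<^sub>k\<^sup>5 / f\<^bsub>2k\<^esub>\<close>; see \<open>psi_jac_eq\<close> and \<open>phi_jac_eq\<close> below.
\<close>

definition psi_jac :: "nat \<Rightarrow> int fps" where
  "psi_jac k = psi k * jac (2 * k)"

definition phi_jac :: "nat \<Rightarrow> int fps" where
  "phi_jac k = phi k * jac k"

lemma psi_jac_theta_series:
  assumes "k > 0"
  shows "psi_jac k = theta_series UNIV (\<lambda>(m, l). sgn_pow l * (2 * l + 1)) (\<lambda>(m, l). k * (tri m + 2 * tri l))"
proof -
  have "psi_jac k = theta_series (UNIV \<times> UNIV) (\<lambda>(m, l). 1 * (sgn_pow l * (2 * l + 1)))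
      (\<lambda>(m, l). k * tri m + 2 * k * tri l)"
    unfolding psi_jac_def psi_def jac_def
    by (rule theta_series_mult) (use assms finite_tri_fibre[of k] finite_tri_fibre[of "2 * k"] in simp_all)
  also have "\<dots> = theta_series UNIV (\<lambda>(m, l). sgn_pow l * (2 * l + 1)) (\<lambda>(m, l). k * (tri m + 2 * tri l))"
    by (rule theta_series_cong) (auto simp: algebra_simps)
  finally show ?thesis .
qed

lemma phi_jac_theta_series:
  assumes "k > 0"
  shows "phi_jac k = theta_series UNIV (\<lambda>(m, l). sgn_pow m * (sgn_pow l * (2 * l + 1)))
           (\<lambda>(m, l). k * (nat (m ^ 2) + tri l))"
proof -
  have "phi_jac k = theta_series (UNIV \<times> UNIV) (\<lambda>(m, l). sgn_pow m * (sgn_pow l * (2 * l + 1)))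
      (\<lambda>(m, l). k * nat (m ^ 2) + k * tri l)"
    unfolding phi_jac_def phi_def jac_def
    by (rule theta_series_mult) (use assms finite_tri_fibre[of k] finite_square_fibre[of k] in simp_all)
  also have "\<dots> = theta_series UNIV (\<lambda>(m, l). sgn_pow m * (sgn_pow l * (2 * l + 1)))
      (\<lambda>(m, l). k * (nat (m ^ 2) + tri l))"
    by (rule theta_series_cong) (auto simp: algebra_simps)
  finally show ?thesis .
qed

lemma finite_psi_jac_fibre:
  "finite {p \<in> UNIV. (case p of (m, l) \<Rightarrow> tri m + 2 * tri l) = N}"
proof (rule finite_subset)
  show "{p \<in> UNIV. (case p of (m, l) \<Rightarrow> tri m + 2 * tri l) = N} \<subseteq>
      (\<Union>t\<le>N. {m. 1 * tri m = t}) \<times> (\<Union>t\<le>N. {l. 1 * tri l = t})"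
    by auto
qed (intro finite_cartesian_product finite_UN_I finite_tri_fibre; simp)

lemma finite_phi_jac_fibre:
  "finite {p \<in> UNIV. (case p of (m, l) \<Rightarrow> nat (m ^ 2) + tri l) = N}"
proof (rule finite_subset)
  show "{p \<in> UNIV. (case p of (m, l) \<Rightarrow> nat (m ^ 2) + tri l) = N} \<subseteq>
      (\<Union>t\<le>N. {m. 1 * nat (m ^ 2) = t}) \<times> (\<Union>t\<le>N. {l. 1 * tri l = t})"
    by auto
qed (intro finite_cartesian_product finite_UN_I finite_tri_fibre finite_square_fibre; simp)

section \<open>The action of the extraction operator\<close>

text \<open>
  The pairs \<open>(m, l)\<close> that contribute are \<open>(5m + 2, 5l + 2)\<close>. On them the exponent \<open>tri m + 2 tri l\<close>
  becomes \<open>25 (tri m + 2 tri l) + 9 = 5 (5 (tri m + 2 tri l) + 1) + 4\<close>, the sign stays and the weight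
  \<open>2l + 1\<close> becomes \<open>5 (2l + 1)\<close>.
\<close>

theorem U5_psi_jac: "U5 (psi_jac 1) = 5 * (fps_X * psi_jac 5)"
proof -
  let ?h = "\<lambda>(m, l). (5 * m + 2, 5 * l + 2) :: int \<times> int"
  have "U5 (psi_jac 1) = fps_const 5 * theta_series UNIV (\<lambda>(m, l). sgn_pow l * (2 * l + 1))
     (\<lambda>p. Suc (case p of (m, l) \<Rightarrow> 5 * (tri m + 2 * tri l)))"
    unfolding psi_jac_theta_series[OF zero_less_one]
  proof (rule U5_theta_series_reindex[where h = ?h])
    fix p :: "int \<times> int"
    assume p: "(case p of (m, l) \<Rightarrow> 1 * (tri m + 2 * tri l)) mod 5 = 4"
    obtain m l where ml: "p = (m, l)" by force
    with p have "m mod 5 = 2 \<and> l mod 5 = 2"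
      using tri_plus_two_tri_mod_5[of m l] by simp
    then have "p = ?h (m div 5, l div 5)"
      unfolding ml using mult_div_mod_eq[of 5 m] mult_div_mod_eq[of 5 l] by simp
    then show "p \<in> range ?h" by (rule range_eqI)
  qed (auto simp: inj_on_def tri_5_2 sgn_pow_5)
  also have "\<dots> = 5 * (fps_X * psi_jac 5)"
    unfolding psi_jac_theta_series[OF zero_less_numeral] X_mult_theta_series by (simp add: numeral_fps_const)
  finally show ?thesis .
qed

text \<open>
  The pairs \<open>(m, l)\<close> that contribute are \<open>(5m, 5l + 2)\<close>. On them the exponent \<open>m\<^sup>2 + tri l + 1\<close>, shifted
  by the additional factor \<open>q\<close>, becomes \<open>25 (m\<^sup>2 + tri l) + 4\<close>, and the weight \<open>2l + 1\<close> becomes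
  \<open>5 (2l + 1)\<close>.
\<close>

theorem U5_X_phi_jac: "U5 (fps_X * phi_jac 1) = 5 * phi_jac 5"
proof -
  let ?h = "\<lambda>(m, l). (5 * m, 5 * l + 2) :: int \<times> int"
  have "U5 (fps_X * phi_jac 1) = fps_const 5 * theta_series UNIV (\<lambda>(m, l). sgn_pow m * (sgn_pow l * (2 * l + 1)))
     (\<lambda>(m, l). 5 * (nat (m ^ 2) + tri l))"
    unfolding phi_jac_theta_series[OF zero_less_one] X_mult_theta_series
  proof (rule U5_theta_series_reindex[where h = ?h])
    fix p :: "int \<times> int"
    assume p: "Suc (case p of (m, l) \<Rightarrow> 1 * (nat (m ^ 2) + tri l)) mod 5 = 4"
    obtain m l where ml: "p = (m, l)" by force
    with p have "(nat (m ^ 2) + tri l) mod 5 = 3"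
      by (simp add: mod_Suc split: if_splits)
    then have "m mod 5 = 0 \<and> l mod 5 = 2"
      by (rule square_plus_tri_mod_5)
    then have "p = ?h (m div 5, l div 5)"
      unfolding ml using mult_div_mod_eq[of 5 m] mult_div_mod_eq[of 5 l] by simp
    then show "p \<in> range ?h" by (rule range_eqI)
  qed (auto simp: inj_on_def tri_5_2 sgn_pow_5 power_mult_distrib nat_mult_distrib)
  also have "\<dots> = 5 * phi_jac 5"
    unfolding phi_jac_theta_series[OF zero_less_numeral] by (simp add: numeral_fps_const)
  finally show ?thesis .
qed

lemma U5_psi_jac_mult: "U5 (psi_jac 1 * phi_jac 5) = U5 (psi_jac 1) * phi_jac 1"
proof -
  have "phi_jac 5 = theta_series UNIV (\<lambda>(m, l). sgn_pow m * (sgn_pow l * (2 * l + 1)))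
      (\<lambda>p. 5 * (case p of (m, l) \<Rightarrow> nat (m ^ 2) + tri l))"
    unfolding phi_jac_theta_series[OF zero_less_numeral] by (rule theta_series_cong) auto
  then show ?thesis
    using U5_mult_theta_series_5[OF finite_psi_jac_fibre finite_phi_jac_fibre]
    by (simp add: psi_jac_theta_series phi_jac_theta_series)
qed

lemma U5_X_phi_jac_mult: "U5 (fps_X * phi_jac 1 * psi_jac 5) = U5 (fps_X * phi_jac 1) * psi_jac 1"
proof -
  have psi: "psi_jac 5 = theta_series UNIV (\<lambda>(m, l). sgn_pow l * (2 * l + 1))
      (\<lambda>p. 5 * (case p of (m, l) \<Rightarrow> tri m + 2 * tri l))"
    unfolding psi_jac_theta_series[OF zero_less_numeral] by (rule theta_series_cong) auto
  have "finite {p \<in> UNIV. Suc (case p of (m, l) \<Rightarrow> nat (m ^ 2) + tri l) = N}" for N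
    by (rule finite_subset[OF _ finite_phi_jac_fibre[of "N - 1"]]) auto
  from U5_mult_theta_series_5[OF this finite_psi_jac_fibre] show ?thesis
    unfolding psi by (simp add: psi_jac_theta_series phi_jac_theta_series X_mult_theta_series)
qed

lemma psi_jac_eq: "k > 0 \<Longrightarrow> psi_jac k * euler_prod k = 4 * euler_prod (2 * k) ^ 5"
proof -
  assume k: "k > 0"
  have "psi_jac k * euler_prod k = (euler_prod k * psi k) * jac (2 * k)"
    by (simp add: psi_jac_def mult_ac)
  also have "\<dots> = 4 * euler_prod (2 * k) ^ 5"
    using k by (simp add: psi_eq jac_eq flip: power_add)
  finally show ?thesis .
qed

lemma phi_jac_eq: "k > 0 \<Longrightarrow> phi_jac k * euler_prod (2 * k) = 2 * euler_prod k ^ 5"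
proof -
  assume k: "k > 0"
  have "phi_jac k * euler_prod (2 * k) = (euler_prod (2 * k) * phi k) * jac k"
    by (simp add: phi_jac_def mult_ac)
  also have "\<dots> = 2 * euler_prod k ^ 5"
    using k by (simp add: phi_eq jac_eq flip: power_add)
  finally show ?thesis .
qed

lemma fps_quot_scaled:
  assumes "fps_nth h 0 = 1" "f * h = fps_const a * g"
  shows "fps_const a * (g //\<^sub>q h) = f"
proof -
  have "fps_const a * (g //\<^sub>q h) * h = f * h"
    using assms fps_quot_mult[OF assms(1), of g] by (simp add: mult.assoc)
  moreover have "h \<noteq> 0"
    using assms(1) by auto
  ultimately show ?thesis by simp
qed

text \<open>
  The factor \<open>8\<close> comes from the three series \<open>psi\<close>, \<open>jac\<close>, \<open>jac\<close> in the product, each of which counts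
  every term of the usual series twice.
\<close>

lemma Psi_eq:
  "fps_const 8 * Psi \<alpha> = (if odd \<alpha> then fps_X * phi_jac 1 * psi_jac 5 else psi_jac 1 * phi_jac 5)"
proof -
  have psi: "psi_jac 1 * euler_prod 1 = 4 * euler_prod 2 ^ 5" "psi_jac 5 * euler_prod 5 = 4 * euler_prod 10 ^ 5"
    using psi_jac_eq[of 1] psi_jac_eq[of 5] by simp_all
  have phi: "phi_jac 1 * euler_prod 2 = 2 * euler_prod 1 ^ 5" "phi_jac 5 * euler_prod 10 = 2 * euler_prod 5 ^ 5"
    using phi_jac_eq[of 1] phi_jac_eq[of 5] by simp_all
  have "(phi_jac 1 * psi_jac 5) * (euler_prod 2 * euler_prod 5) =
      (phi_jac 1 * euler_prod 2) * (psi_jac 5 * euler_prod 5)"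
    by (simp only: mult_ac)
  also have "\<dots> = fps_const 8 * (euler_prod 1 ^ 5 * euler_prod 10 ^ 5)"
    unfolding psi phi by (simp add: numeral_fps_const[symmetric])
  finally have "fps_const 8 * ((euler_prod 1 ^ 5 * euler_prod 10 ^ 5) //\<^sub>q (euler_prod 2 * euler_prod 5)) =
      phi_jac 1 * psi_jac 5"
    by (intro fps_quot_scaled) (simp_all add: euler_prod_nth_0)
  moreover have "(psi_jac 1 * phi_jac 5) * (euler_prod 1 * euler_prod 10) =
      (psi_jac 1 * euler_prod 1) * (phi_jac 5 * euler_prod 10)"
    by (simp only: mult_ac)
  then have "(psi_jac 1 * phi_jac 5) * (euler_prod 1 * euler_prod 10) =
      fps_const 8 * (euler_prod 2 ^ 5 * euler_prod 5 ^ 5)"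
    unfolding psi phi by (simp add: numeral_fps_const[symmetric])
  then have "fps_const 8 * ((euler_prod 2 ^ 5 * euler_prod 5 ^ 5) //\<^sub>q (euler_prod 1 * euler_prod 10)) =
      psi_jac 1 * phi_jac 5"
    by (intro fps_quot_scaled) (simp_all add: euler_prod_nth_0)
  ultimately show ?thesis
    unfolding Psi_def by (auto simp: mult.left_commute mult.assoc)
qed

text \<open>
  The operator exchanges the two series: it acts on the factor of index \<open>1\<close>, moving it to index \<open>5\<close>,
  and moves the factor of index \<open>5\<close> to index \<open>1\<close>.
\<close>

theorem U5_Psi: "U5 (Psi \<alpha>) = 5 * Psi (Suc \<alpha>)"
proof -
  have "fps_const 8 * U5 (Psi \<alpha>) = U5 (fps_const 8 * Psi \<alpha>)"
    by (rule U5_const_mult[symmetric])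
  also have "\<dots> = 5 * (fps_const 8 * Psi (Suc \<alpha>))"
  proof (cases "even \<alpha>")
    case True
    then have "U5 (fps_const 8 * Psi \<alpha>) = 5 * (fps_X * psi_jac 5) * phi_jac 1"
      unfolding Psi_eq by (simp only: U5_psi_jac_mult U5_psi_jac simp_thms if_False)
    with True show ?thesis
      unfolding Psi_eq by (simp add: mult_ac)
  next
    case False
    then have "U5 (fps_const 8 * Psi \<alpha>) = 5 * phi_jac 5 * psi_jac 1"
      unfolding Psi_eq by (simp only: U5_X_phi_jac_mult U5_X_phi_jac simp_thms if_True)
    with False show ?thesis
      unfolding Psi_eq by (simp add: mult_ac)
  qed
  also have "\<dots> = fps_const 8 * (5 * Psi (Suc \<alpha>))"
    by (rule mult.left_commute)
  finally show ?thesis by simp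
qed

theorem theorem3:
  fixes M :: "nat \<Rightarrow> int"
  assumes "Abs_fps M = (euler_prod 2 ^ 5 * euler_prod 5 ^ 5) //\<^sub>q (euler_prod 1 * euler_prod 10)"
  shows "\<forall>\<alpha>::nat. \<alpha> \<ge> 1 \<longrightarrow>
    Abs_fps (\<lambda>n. M (5 ^ \<alpha> * n + 5 ^ \<alpha> - 1)) = 5 ^ \<alpha> * Psi \<alpha>"
proof -
  \<comment> \<open>For \<open>\<alpha> = 0\<close> the formula is the definition of \<open>M\<close>, so the induction can start there.\<close>
  have "Abs_fps (\<lambda>n. M (5 ^ \<alpha> * n + 5 ^ \<alpha> - 1)) = 5 ^ \<alpha> * Psi \<alpha>" for \<alpha>
  proof (induction \<alpha>)
    case 0
    then show ?case
      using assms by (simp add: Psi_def)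
  next
    case (Suc \<alpha>)
    have "5 ^ Suc \<alpha> * n + 5 ^ Suc \<alpha> - 1 = 5 ^ \<alpha> * (5 * n + 4) + 5 ^ \<alpha> - (1 :: nat)" for n
      by (simp add: algebra_simps)
    then have "Abs_fps (\<lambda>n. M (5 ^ Suc \<alpha> * n + 5 ^ Suc \<alpha> - 1)) =
        U5 (Abs_fps (\<lambda>n. M (5 ^ \<alpha> * n + 5 ^ \<alpha> - 1)))"
      by (simp only: U5_def fps_nth_Abs_fps)
    also have "\<dots> = U5 (fps_const (5 ^ \<alpha>) * Psi \<alpha>)"
      unfolding Suc.IH by (simp add: numeral_fps_const fps_const_power)
    also have "\<dots> = 5 ^ Suc \<alpha> * Psi (Suc \<alpha>)"
      unfolding U5_const_mult U5_Psi by (simp add: numeral_fps_const fps_const_power mult_ac)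
    finally show ?case .
  qed
  then show ?thesis by simp
qed

end
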